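(* Let $G=(V,E,\vartheta,w)$ be a connected, locally finite, stochastically complete weighted graph with $D^{\epsilon}_{\vartheta}<\infty$, $\vartheta_{\max}<\infty$, $\omega_{\min}>0$, where $\epsilon\in(0,1)$. Let $C_0,c_1,c_2\in\mathbb{R}$ be constants with $|b(x,t)|\le C_0$ and $\gamma(t)\le c_1+\frac{c_2}{t}$, where $b$ and $\gamma$ are the coefficients of the equation $\Delta^{\epsilon}u-b(x,t)u=u_t+\gamma(t)u$. Then the first nonzero eigenvalue $\lambda_1$ of the fractional Laplacian $-\Delta^{\epsilon}$ satisfies $$\lambda_1\le C\max\left(\sqrt{K}\,h,\;h^2\right),$$ where $h$ is the Cheeger constant, $K=2D^{\epsilon}_{\vartheta}+C_0+c_1$, and $C>0$ is a constant depending on $D^{\epsilon}_{\vartheta}$, $\omega_{\min}$ and $\vartheta_{\max}$.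
   Context: $G=(V,E,\vartheta,w)$ is a graph with vertex set $V$, edge set $E$, vertex measure $\vartheta:V\to(0,\infty)$ and symmetric edge weights $w_{xy}=w_{yx}>0$ if $x\sim y$ (adjacent), $w_{xy}=0$ otherwise. Locally finite: every vertex has finitely many neighbors. Let $p_t(x,y)$ be the heat kernel of $G$ (associated with $\Delta f(x)=\frac{1}{\vartheta(x)}\sum_{y\sim x}w_{xy}(f(y)-f(x))$). $G$ is stochastically complete if $\sum_{y\in V}p_t(x,y)\vartheta(y)=1$ for all $t>0$, $x\in V$. For $\epsilon\in(0,1)$ and $x\ne y$, $W_{\epsilon}(x,y)=\frac{\epsilon}{\Gamma(1-\epsilon)}\vartheta(x)\vartheta(y)\int_0^{\infty}p_t(x,y)t^{-1-\epsilon}\,dt$, where $\Gamma(1-\epsilon)$ is the Gamma function. For $f:V\to\mathbb{R}$, $$\Delta^{\epsilon}f(x)=\frac{1}{\vartheta(x)}\sum_{y\in V,\,y\ne x}W_{\epsilon}(x,y)(f(y)-f(x)).$$ Constants: $D^{\epsilon}_{\vartheta}:=\max_{x\in V}\frac{\sum_{y\ne x}W_{\epsilon}(x,y)}{\vartheta(x)}$, $\vartheta_{\max}:=\sup_{x\in V}\vartheta(x)$, $\omega_{\min}:=\inf_{x,y\in V,\,x\ne y}W_{\epsilon}(x,y)$. $u_t$ is the time derivative. Cheeger constant: $$h=\inf_{\emptyset\ne U\subset V,\ \mathrm{vol}(U)\le\frac12\mathrm{vol}(V)}\frac{|\partial U|}{\mathrm{vol}(U)},\qquad |\partial U|=\sum_{x\in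 U,\,y\notin U}W_{\epsilon}(x,y),\quad \mathrm{vol}(U)=\sum_{x\in U}\vartheta(x).$$ *)

theory Defs
  imports "HOL-Analysis.Analysis"
begin

record 'v wgraph =
  verts :: "'v set"
  edges :: "('v \<times> 'v) set"
  vmeas :: "'v \<Rightarrow> real"
  weight :: "'v \<Rightarrow> 'v \<Rightarrow> real"

definition weighted_graph :: "'v wgraph \<Rightarrow> bool" where
  "weighted_graph G \<longleftrightarrow>
     edges G \<subseteq> verts G \<times> verts G \<and> sym (edges G) \<and>
     (\<forall>x\<in>verts G. vmeas G x > 0) \<and>
     (\<forall>x y. weight G x y = weight G y x) \<and>
     (\<forall>x y. (x, y) \<in> edges G \<longrightarrow> weight G x y > 0) \<and>
     (\<forall>x y. (x, y) \<notin> edges G \<longrightarrow> weight G x y = 0)"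

definition locally_finite_graph :: "'v wgraph \<Rightarrow> bool" where
  "locally_finite_graph G \<longleftrightarrow> (\<forall>x\<in>verts G. finite {y. (x, y) \<in> edges G})"

definition connected_graph :: "'v wgraph \<Rightarrow> bool" where
  "connected_graph G \<longleftrightarrow> (\<forall>x\<in>verts G. \<forall>y\<in>verts G. (x, y) \<in> (edges G)\<^sup>*)"

definition laplacian :: "'v wgraph \<Rightarrow> ('v \<Rightarrow> real) \<Rightarrow> 'v \<Rightarrow> real" where
  "laplacian G f x = (\<Sum>y | (x, y) \<in> edges G. weight G x y * (f y - f x)) / vmeas G x"

text \<open>
  The heat kernel of a locally finite (possibly infinite) graph is the limit, along finite sets
  exhausting the vertices, of the Dirichlet heat kernels
  \<open>p\<^sub>t\<^sup>U(x, y) = (exp (t \<Delta>\<^sub>U) \<delta>\<^sub>y)(x) / \<vartheta>(y)\<close>, for \<open>x, y \<in> U\<close>; it is the minimal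
  nonnegative fundamental solution of the heat equation. By domain monotonicity the limit
  over the directed set of all finite sets is the limit along any exhausting sequence.
\<close>

definition dirichlet_laplacian :: "'v wgraph \<Rightarrow> 'v set \<Rightarrow> ('v \<Rightarrow> real) \<Rightarrow> 'v \<Rightarrow> real" where
  "dirichlet_laplacian G U f x =
     (if x \<in> U then laplacian G (\<lambda>y. if y \<in> U then f y else 0) x else 0)"

definition dirichlet_heat_kernel :: "'v wgraph \<Rightarrow> 'v set \<Rightarrow> real \<Rightarrow> 'v \<Rightarrow> 'v \<Rightarrow> real" where
  "dirichlet_heat_kernel G U t x y =
     (\<Sum>n. t ^ n / fact n * ((dirichlet_laplacian G U ^^ n) (indicator {y})) x) / vmeas G y"

definition heat_kernel :: "'v wgraph \<Rightarrow> real \<Rightarrow> 'v \<Rightarrow> 'v \<Rightarrow> real" where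
  "heat_kernel G t x y =
     Lim (finite_subsets_at_top (verts G)) (\<lambda>U. dirichlet_heat_kernel G U t x y)"

definition stochastically_complete :: "'v wgraph \<Rightarrow> bool" where
  "stochastically_complete G \<longleftrightarrow>
     (\<forall>t>0. \<forall>x\<in>verts G. ((\<lambda>y. heat_kernel G t x y * vmeas G y) has_sum 1) (verts G))"

definition frac_weight :: "'v wgraph \<Rightarrow> real \<Rightarrow> 'v \<Rightarrow> 'v \<Rightarrow> real" where
  "frac_weight G \<epsilon> x y =
     \<epsilon> / Gamma (1 - \<epsilon>) * vmeas G x * vmeas G y *
     (LINT t:{0<..}|lborel. heat_kernel G t x y * t powr (- 1 - \<epsilon>))"

text \<open>
  The constants below are extended nonnegative reals, so that their finiteness is a meaningful
  hypothesis. If \<open>frac_degree G \<epsilon>\<close> is finite and \<open>weight_min G \<epsilon>\<close> is positive, then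
  \<open>verts G\<close> is finite, so all real-valued infinite sums below are then finite sums.
\<close>

definition frac_degree :: "'v wgraph \<Rightarrow> real \<Rightarrow> ennreal" where
  "frac_degree G \<epsilon> =
     (SUP x\<in>verts G. (\<Sum>\<^sub>\<infinity>y\<in>verts G - {x}. ennreal (frac_weight G \<epsilon> x y)) / ennreal (vmeas G x))"

definition vmeas_max :: "'v wgraph \<Rightarrow> ennreal" where
  "vmeas_max G = (SUP x\<in>verts G. ennreal (vmeas G x))"

definition weight_min :: "'v wgraph \<Rightarrow> real \<Rightarrow> ennreal" where
  "weight_min G \<epsilon> =
     (INF (x, y)\<in>{(x, y). x \<in> verts G \<and> y \<in> verts G \<and> x \<noteq> y}. ennreal (frac_weight G \<epsilon> x y))"

definition frac_laplacian :: "'v wgraph \<Rightarrow> real \<Rightarrow> ('v \<Rightarrow> real) \<Rightarrow> 'v \<Rightarrow> real" where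
  "frac_laplacian G \<epsilon> f x =
     (\<Sum>\<^sub>\<infinity>y\<in>verts G - {x}. frac_weight G \<epsilon> x y * (f y - f x)) / vmeas G x"

definition is_eigenvalue :: "'v wgraph \<Rightarrow> real \<Rightarrow> real \<Rightarrow> bool" where
  "is_eigenvalue G \<epsilon> \<mu> \<longleftrightarrow>
     (\<exists>f. (\<exists>x\<in>verts G. f x \<noteq> 0) \<and> (\<forall>x\<in>verts G. - frac_laplacian G \<epsilon> f x = \<mu> * f x))"

definition is_first_nonzero_eigenvalue :: "'v wgraph \<Rightarrow> real \<Rightarrow> real \<Rightarrow> bool" where
  "is_first_nonzero_eigenvalue G \<epsilon> \<mu> \<longleftrightarrow>
     is_eigenvalue G \<epsilon> \<mu> \<and> \<mu> \<noteq> 0 \<and> (\<forall>\<nu>. is_eigenvalue G \<epsilon> \<nu> \<and> \<nu> \<noteq> 0 \<longrightarrow> \<mu> \<le> \<nu>)"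

definition vol :: "'v wgraph \<Rightarrow> 'v set \<Rightarrow> real" where
  "vol G U = (\<Sum>\<^sub>\<infinity>x\<in>U. vmeas G x)"

definition boundary_size :: "'v wgraph \<Rightarrow> real \<Rightarrow> 'v set \<Rightarrow> real" where
  "boundary_size G \<epsilon> U = (\<Sum>\<^sub>\<infinity>(x, y)\<in>U \<times> (verts G - U). frac_weight G \<epsilon> x y)"

definition cheeger :: "'v wgraph \<Rightarrow> real \<Rightarrow> real" where
  "cheeger G \<epsilon> =
     (INF U\<in>{U. U \<noteq> {} \<and> U \<subset> verts G \<and> vol G U \<le> vol G (verts G) / 2}.
        boundary_size G \<epsilon> U / vol G U)"

end

theory Submission imports Defs begin

text \<open>
  The two conditions \<open>frac_degree G \<epsilon> < \<infinity>\<close> and \<open>weight_min G \<epsilon> > 0\<close> together make the fractional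
  Laplacian an operator on a finite complete graph whose size is controlled: every vertex is joined
  to every other one by an edge of weight at least \<open>\<omega> = weight_min G \<epsilon>\<close>, and the total weight at
  a vertex is finite. On such a graph both sides of the inequality are controlled by
  \<open>d = frac_degree G \<epsilon>\<close>, \<open>\<omega>\<close> and \<open>m = vmeas_max G\<close>.

  An eigenvalue is at most \<open>2 d\<close> by Gershgorin's argument, that is, by reading the eigenvalue
  equation at a vertex where the modulus of the eigenfunction is maximal (\<open>eigenvalue_le\<close>).
  On the other hand each vertex of a set \<open>U \<noteq> V\<close> sends at least one edge out of \<open>U\<close>, of weight at
  least \<open>\<omega>\<close>, and contributes at most \<open>m\<close> to the volume of \<open>U\<close>, so that \<open>h \<ge> \<omega> / m\<close>
  (\<open>cheeger_ge\<close>). Hence \<open>\<lambda>\<^sub>1 \<le> 2 d \<le> 2 d (m / \<omega>)\<^sup>2 h\<^sup>2\<close>, and \<open>h\<^sup>2\<close> is one of the two terms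
  of the maximum.
\<close>

lemma weight_min_le_frac_weight:
  assumes "x \<in> verts G" "y \<in> verts G" "x \<noteq> y"
  shows "weight_min G \<epsilon> \<le> ennreal (frac_weight G \<epsilon> x y)"
  unfolding weight_min_def by (rule INF_lower2[of "(x, y)"]) (use assms in auto)

lemma frac_weight_pos:
  assumes "weight_min G \<epsilon> > 0" "x \<in> verts G" "y \<in> verts G" "x \<noteq> y"
  shows "frac_weight G \<epsilon> x y > 0"
  using weight_min_le_frac_weight[OF assms(2-4), of \<epsilon>] assms(1)
  by (metis ennreal_neg leI less_le_trans not_less_zero)

lemma enn2real_weight_min:
  assumes "weight_min G \<epsilon> > 0" "x \<in> verts G" "y \<in> verts G" "x \<noteq> y"
  shows "enn2real (weight_min G \<epsilon>) > 0"
    and "enn2real (weight_min G \<epsilon>) \<le> frac_weight G \<epsilon> x y"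
proof -
  note le = weight_min_le_frac_weight[OF assms(2-4), of \<epsilon>]
  then have "weight_min G \<epsilon> < \<infinity>"
    using ennreal_less_top le_less_trans by (metis infinity_ennreal_def)
  then show "enn2real (weight_min G \<epsilon>) > 0"
    using assms(1) by (simp add: enn2real_positive_iff)
  show "enn2real (weight_min G \<epsilon>) \<le> frac_weight G \<epsilon> x y"
    using enn2real_mono[OF le] frac_weight_pos[OF assms] by simp
qed

lemma vmeas_le_enn2real_vmeas_max:
  assumes "vmeas_max G < \<infinity>" "x \<in> verts G" "vmeas G x > 0"
  shows "vmeas G x \<le> enn2real (vmeas_max G)"
proof -
  have "ennreal (vmeas G x) \<le> vmeas_max G"
    unfolding vmeas_max_def using assms(2) by (rule SUP_upper)
  then show ?thesis
    using enn2real_mono[of "ennreal (vmeas G x)" "vmeas_max G"] assms by simp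
qed

text \<open>
  If there were infinitely many vertices, the weights at a single vertex, being bounded below by a
  positive constant, would have an infinite sum.
\<close>

lemma finite_verts:
  assumes pos: "\<And>x. x \<in> verts G \<Longrightarrow> vmeas G x > 0"
    and deg: "frac_degree G \<epsilon> < \<infinity>" and wmin: "weight_min G \<epsilon> > 0"
  shows "finite (verts G)"
proof (rule ccontr)
  assume inf: "infinite (verts G)"
  then obtain x where x: "x \<in> verts G"
    by (metis finite.emptyI ex_in_conv)
  let ?S = "\<Sum>\<^sub>\<infinity>y\<in>verts G - {x}. ennreal (frac_weight G \<epsilon> x y)"
  have "?S = \<infinity>"
    using infsum_superconst_infinite_ennreal[of "verts G - {x}" "weight_min G \<epsilon>"
        "\<lambda>y. ennreal (frac_weight G \<epsilon> x y)"] weight_min_le_frac_weight[OF x] wmin inf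
    by auto
  then have "?S / ennreal (vmeas G x) = \<infinity>"
    by (simp add: ennreal_top_divide)
  moreover have "?S / ennreal (vmeas G x) \<le> frac_degree G \<epsilon>"
    unfolding frac_degree_def using x by (rule SUP_upper)
  ultimately show False
    using deg by (simp add: top_unique)
qed

lemma sum_frac_weight_le:
  assumes fin: "finite (verts G)" and x: "x \<in> verts G" and pos: "vmeas G x > 0"
    and deg: "frac_degree G \<epsilon> < \<infinity>" and wmin: "weight_min G \<epsilon> > 0"
  shows "(\<Sum>y\<in>verts G - {x}. frac_weight G \<epsilon> x y) \<le> enn2real (frac_degree G \<epsilon>) * vmeas G x"
proof -
  let ?s = "\<Sum>y\<in>verts G - {x}. frac_weight G \<epsilon> x y"
  have nonneg: "frac_weight G \<epsilon> x y \<ge> 0" if "y \<in> verts G - {x}" for y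
    using frac_weight_pos[OF wmin x, of y] that by force
  have "?s \<ge> 0"
    using nonneg by (rule sum_nonneg)
  have "(\<Sum>\<^sub>\<infinity>y\<in>verts G - {x}. ennreal (frac_weight G \<epsilon> x y)) = ennreal ?s"
    using fin sum_ennreal[of "verts G - {x}" "frac_weight G \<epsilon> x", OF nonneg] by simp
  then have "ennreal ?s / ennreal (vmeas G x) \<le> frac_degree G \<epsilon>"
    unfolding frac_degree_def using SUP_upper[OF x,
        of "\<lambda>x. (\<Sum>\<^sub>\<infinity>y\<in>verts G - {x}. ennreal (frac_weight G \<epsilon> x y)) / ennreal (vmeas G x)"]
    by simp
  moreover have "ennreal ?s / ennreal (vmeas G x) = ennreal (?s / vmeas G x)"
    using \<open>?s \<ge> 0\<close> pos by (simp add: divide_ennreal)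
  ultimately have "?s / vmeas G x \<le> enn2real (frac_degree G \<epsilon>)"
    using enn2real_mono[of "ennreal (?s / vmeas G x)" "frac_degree G \<epsilon>"] deg \<open>?s \<ge> 0\<close> pos
    by simp
  then show ?thesis
    using pos by (simp add: pos_divide_le_eq)
qed

text \<open>
  At a vertex \<open>x\<close> where \<open>\<bar>f\<bar>\<close> is maximal, \<open>\<bar>f y - f x\<bar> \<le> 2 \<bar>f x\<bar>\<close> for all \<open>y\<close>, so the modulus of
  the fractional Laplacian of \<open>f\<close> at \<open>x\<close> is at most \<open>2 \<bar>f x\<bar>\<close> times the degree.
\<close>

lemma eigenvalue_le:
  assumes fin: "finite (verts G)" and pos: "\<And>x. x \<in> verts G \<Longrightarrow> vmeas G x > 0"
    and deg: "frac_degree G \<epsilon> < \<infinity>" and wmin: "weight_min G \<epsilon> > 0"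
    and eig: "is_eigenvalue G \<epsilon> \<mu>"
  shows "\<bar>\<mu>\<bar> \<le> 2 * enn2real (frac_degree G \<epsilon>)"
proof -
  obtain f z where z: "z \<in> verts G" "f z \<noteq> 0"
    and eq: "\<And>x. x \<in> verts G \<Longrightarrow> - frac_laplacian G \<epsilon> f x = \<mu> * f x"
    using eig unfolding is_eigenvalue_def by blast
  let ?M = "Max ((\<lambda>x. \<bar>f x\<bar>) ` verts G)"
  have "?M \<in> (\<lambda>x. \<bar>f x\<bar>) ` verts G"
    using fin z(1) by (intro Max_in) auto
  then obtain x where x: "x \<in> verts G" and "\<bar>f x\<bar> = ?M"
    by force
  then have fmax: "\<bar>f y\<bar> \<le> \<bar>f x\<bar>" if "y \<in> verts G" for y
    using fin that by simp
  have fx: "\<bar>f x\<bar> > 0"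
    using fmax[OF z(1)] z(2) by linarith
  let ?W = "frac_weight G \<epsilon> x" and ?d = "enn2real (frac_degree G \<epsilon>)"
  have "\<mu> * f x * vmeas G x = - (\<Sum>y\<in>verts G - {x}. ?W y * (f y - f x))"
    using eq[OF x] pos[OF x] fin by (simp add: frac_laplacian_def field_simps)
  then have "\<bar>\<mu> * f x * vmeas G x\<bar> \<le> (\<Sum>y\<in>verts G - {x}. \<bar>?W y * (f y - f x)\<bar>)"
    using sum_abs[of "\<lambda>y. ?W y * (f y - f x)" "verts G - {x}"] by simp
  also have "\<dots> \<le> (\<Sum>y\<in>verts G - {x}. ?W y * (2 * \<bar>f x\<bar>))"
  proof (rule sum_mono)
    fix y assume y: "y \<in> verts G - {x}"
    then have "?W y > 0"
      using frac_weight_pos[OF wmin x] by blast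
    moreover have "\<bar>f y - f x\<bar> \<le> 2 * \<bar>f x\<bar>"
      using fmax[of y] y by force
    ultimately show "\<bar>?W y * (f y - f x)\<bar> \<le> ?W y * (2 * \<bar>f x\<bar>)"
      by (simp add: abs_mult)
  qed
  also have "\<dots> = (\<Sum>y\<in>verts G - {x}. ?W y) * (2 * \<bar>f x\<bar>)"
    by (simp add: sum_distrib_right)
  also have "\<dots> \<le> ?d * vmeas G x * (2 * \<bar>f x\<bar>)"
    by (rule mult_right_mono[OF sum_frac_weight_le[OF fin x pos[OF x] deg wmin]]) simp
  finally have "\<bar>\<mu>\<bar> * (\<bar>f x\<bar> * vmeas G x) \<le> 2 * ?d * (\<bar>f x\<bar> * vmeas G x)"
    using pos[OF x] by (simp add: abs_mult mult_ac)
  then show ?thesis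
    using fx pos[OF x] by simp
qed

text \<open>
  The infimum defining the Cheeger constant ranges over a nonempty family: a vertex of least
  measure carries at most half of the volume as soon as there is another vertex. The lower bound
  keeps, of the edges leaving a set, just those that end in one fixed vertex of the complement.
\<close>

lemma cheeger_ge:
  assumes fin: "finite (verts G)" and pos: "\<And>x. x \<in> verts G \<Longrightarrow> vmeas G x > 0"
    and bound: "\<And>x. x \<in> verts G \<Longrightarrow> vmeas G x \<le> m"
    and w: "\<And>x y. \<lbrakk>x \<in> verts G; y \<in> verts G; x \<noteq> y\<rbrakk> \<Longrightarrow> \<omega> \<le> frac_weight G \<epsilon> x y"
    and "\<omega> > 0" and ab: "a \<in> verts G" "b \<in> verts G" "a \<noteq> b"
  shows "\<omega> / m \<le> cheeger G \<epsilon>"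
  unfolding cheeger_def
proof (rule cINF_greatest)
  have "m > 0"
    using pos[OF ab(1)] bound[OF ab(1)] by linarith
  obtain x where x: "x \<in> verts G" and least: "\<And>y. y \<in> verts G \<Longrightarrow> vmeas G x \<le> vmeas G y"
    using ex_min_if_finite[of "vmeas G ` verts G"] fin ab(1) by (force simp: not_less)
  obtain y where y: "y \<in> verts G" "y \<noteq> x"
    using ab by metis
  have "(\<Sum>z\<in>{x, y}. vmeas G z) \<le> (\<Sum>z\<in>verts G. vmeas G z)"
    using fin x y pos by (intro sum_mono2) (auto intro: less_imp_le)
  then have "2 * vmeas G x \<le> vol G (verts G)"
    using y(2) least[OF y(1)] fin by (simp add: vol_def)
  then show "{U. U \<noteq> {} \<and> U \<subset> verts G \<and> vol G U \<le> vol G (verts G) / 2} \<noteq> {}"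
    using x y by (auto simp: vol_def intro!: exI[of _ "{x}"])
  fix U assume "U \<in> {U. U \<noteq> {} \<and> U \<subset> verts G \<and> vol G U \<le> vol G (verts G) / 2}"
  then have U: "U \<noteq> {}" "U \<subset> verts G"
    by auto
  have finU: "finite U"
    using U(2) fin finite_subset by blast
  obtain z where z: "z \<in> verts G" "z \<notin> U"
    using U(2) by blast
  have "vol G U \<le> m * card U"
    using sum_bounded_above[of U "vmeas G" m] bound U(2) finU by (auto simp: vol_def mult_ac)
  moreover have "vol G U > 0"
    using U finU pos by (auto simp: vol_def intro!: sum_pos)
  moreover have "\<omega> * card U \<le> boundary_size G \<epsilon> U"
  proof -
    have "\<omega> * card U \<le> (\<Sum>x\<in>U. frac_weight G \<epsilon> x z)"
      using sum_bounded_below[of U \<omega> "\<lambda>x. frac_weight G \<epsilon> x z"] w U(2) z by (force simp: mult_ac)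
    also have "\<dots> = (\<Sum>(x, y)\<in>U \<times> {z}. frac_weight G \<epsilon> x y)"
      by (simp add: sum.cartesian_product[symmetric])
    also have "\<dots> \<le> (\<Sum>(x, y)\<in>U \<times> (verts G - U). frac_weight G \<epsilon> x y)"
    proof (rule sum_mono2)
      fix p assume "p \<in> U \<times> (verts G - U) - U \<times> {z}"
      then have "\<omega> \<le> (case p of (x, y) \<Rightarrow> frac_weight G \<epsilon> x y)"
        using U(2) w by auto
      then show "0 \<le> (case p of (x, y) \<Rightarrow> frac_weight G \<epsilon> x y)"
        using \<open>\<omega> > 0\<close> by simp
    qed (use finU fin z in auto)
    also have "\<dots> = boundary_size G \<epsilon> U"
      using finU fin by (simp add: boundary_size_def)
    finally show ?thesis .
  qed
  ultimately show "\<omega> / m \<le> boundary_size G \<epsilon> U / vol G U"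
  proof -
    assume v: "vol G U \<le> m * card U" "vol G U > 0" and e: "\<omega> * card U \<le> boundary_size G \<epsilon> U"
    have "\<omega> * vol G U \<le> \<omega> * (m * card U)"
      using v(1) \<open>\<omega> > 0\<close> by simp
    also have "\<dots> \<le> m * boundary_size G \<epsilon> U"
      using mult_left_mono[OF e, of m] \<open>m > 0\<close> by (simp add: mult_ac)
    finally show ?thesis
      using v(2) \<open>m > 0\<close> by (simp add: field_simps)
  qed
qed

theorem theorem5p3:
  "\<exists>C :: real \<Rightarrow> real \<Rightarrow> real \<Rightarrow> real.
     (\<forall>d \<omega> m. C d \<omega> m > 0) \<and>
     (\<forall>(G :: 'v wgraph) (\<epsilon>::real) (b :: 'v \<Rightarrow> real \<Rightarrow> real) (\<gamma> :: real \<Rightarrow> real)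
        (C\<^sub>0::real) (c\<^sub>1::real) (c\<^sub>2::real) (lambda1::real).
        weighted_graph G \<longrightarrow> connected_graph G \<longrightarrow> locally_finite_graph G \<longrightarrow>
        stochastically_complete G \<longrightarrow>
        0 < \<epsilon> \<longrightarrow> \<epsilon> < 1 \<longrightarrow>
        frac_degree G \<epsilon> < \<infinity> \<longrightarrow> vmeas_max G < \<infinity> \<longrightarrow> weight_min G \<epsilon> > 0 \<longrightarrow>
        (\<forall>x\<in>verts G. \<forall>t>0. \<bar>b x t\<bar> \<le> C\<^sub>0) \<longrightarrow>
        (\<forall>t>0. \<gamma> t \<le> c\<^sub>1 + c\<^sub>2 / t) \<longrightarrow>
        is_first_nonzero_eigenvalue G \<epsilon> lambda1 \<longrightarrow>
        (let h = cheeger G \<epsilon>;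
             K = 2 * enn2real (frac_degree G \<epsilon>) + C\<^sub>0 + c\<^sub>1
         in lambda1 \<le> C (enn2real (frac_degree G \<epsilon>)) (enn2real (weight_min G \<epsilon>))
                     (enn2real (vmeas_max G)) * max (sqrt K * h) (h\<^sup>2)))"
  \<comment> \<open>\<open>\<lambda>\<^sub>1 \<le> 2 d\<close> and \<open>h \<ge> \<omega> / m\<close> dictate the constant; the value \<open>1\<close> keeps it positive at
    arguments that no graph with a nonzero eigenvalue attains.\<close>
proof (intro exI[of _ "\<lambda>d \<omega> m. if d > 0 \<and> \<omega> > 0 \<and> m > 0 then 2 * d * (m / \<omega>)\<^sup>2 else 1"]
    conjI allI impI)
  fix d \<omega> m :: real
  show "(if d > 0 \<and> \<omega> > 0 \<and> m > 0 then 2 * d * (m / \<omega>)\<^sup>2 else 1) > 0"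
    by simp
next
  fix G :: "'v wgraph" and \<epsilon> :: real and b :: "'v \<Rightarrow> real \<Rightarrow> real" and \<gamma> :: "real \<Rightarrow> real"
    and C\<^sub>0 c\<^sub>1 c\<^sub>2 lambda1 :: real
  assume "weighted_graph G"
    and deg: "frac_degree G \<epsilon> < \<infinity>" and mmax: "vmeas_max G < \<infinity>" and wmin: "weight_min G \<epsilon> > 0"
    and "is_first_nonzero_eigenvalue G \<epsilon> lambda1"
  then have pos: "vmeas G x > 0" if "x \<in> verts G" for x
    using that by (simp add: weighted_graph_def)
  have eig: "is_eigenvalue G \<epsilon> lambda1" and "lambda1 \<noteq> 0"
    using \<open>is_first_nonzero_eigenvalue G \<epsilon> lambda1\<close>
    by (simp_all add: is_first_nonzero_eigenvalue_def)
  note fin = finite_verts[OF pos deg wmin]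
  define d where "d = enn2real (frac_degree G \<epsilon>)"
  define \<omega> where "\<omega> = enn2real (weight_min G \<epsilon>)"
  define m where "m = enn2real (vmeas_max G)"
  define h where "h = cheeger G \<epsilon>"
  define K where "K = 2 * d + C\<^sub>0 + c\<^sub>1"

  \<comment> \<open>On a single vertex the fractional Laplacian vanishes, so a nonzero eigenvalue yields two
    vertices.\<close>
  obtain x y where xy: "x \<in> verts G" "y \<in> verts G" "x \<noteq> y"
  proof -
    obtain f z where z: "z \<in> verts G" "f z \<noteq> 0"
      and "- frac_laplacian G \<epsilon> f z = lambda1 * f z"
      using eig unfolding is_eigenvalue_def by blast
    then have "frac_laplacian G \<epsilon> f z \<noteq> 0"
      using \<open>lambda1 \<noteq> 0\<close> by auto
    then have "verts G - {z} \<noteq> {}"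
      unfolding frac_laplacian_def by (metis div_0 infsum_empty)
    then show ?thesis
      using that z(1) by blast
  qed
  have "\<omega> > 0"
    unfolding \<omega>_def using enn2real_weight_min(1)[OF wmin xy] .
  have bound: "vmeas G x \<le> m" if "x \<in> verts G" for x
    unfolding m_def using vmeas_le_enn2real_vmeas_max[OF mmax that pos[OF that]] .
  have "m > 0"
    using bound[OF xy(1)] pos[OF xy(1)] by linarith
  have lam: "lambda1 \<le> 2 * d" and "d > 0"
    using eigenvalue_le[OF fin pos deg wmin eig] \<open>lambda1 \<noteq> 0\<close> by (simp_all add: d_def)
  have "\<omega> / m \<le> h"
    unfolding h_def
    by (rule cheeger_ge[OF fin pos bound _ \<open>\<omega> > 0\<close> xy])
      (simp_all add: \<omega>_def enn2real_weight_min(2)[OF wmin])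
  then have "1 \<le> m / \<omega> * h"
    using \<open>\<omega> > 0\<close> \<open>m > 0\<close> by (simp add: field_simps)
  then have "1 \<le> (m / \<omega> * h)\<^sup>2"
    by (rule one_le_power)
  then have "2 * d * 1 \<le> 2 * d * (m / \<omega> * h)\<^sup>2"
    using \<open>d > 0\<close> by (intro mult_left_mono) simp_all
  also have "\<dots> = 2 * d * (m / \<omega>)\<^sup>2 * h\<^sup>2"
    by (simp only: power_mult_distrib mult.assoc)
  also have "\<dots> \<le> 2 * d * (m / \<omega>)\<^sup>2 * max (sqrt K * h) (h\<^sup>2)"
    using \<open>d > 0\<close> by (intro mult_left_mono) simp_all
  finally have "lambda1 \<le> 2 * d * (m / \<omega>)\<^sup>2 * max (sqrt K * h) (h\<^sup>2)"
    using lam by simp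
  then show "let h = cheeger G \<epsilon>; K = 2 * enn2real (frac_degree G \<epsilon>) + C\<^sub>0 + c\<^sub>1
    in lambda1 \<le> (if enn2real (frac_degree G \<epsilon>) > 0 \<and> enn2real (weight_min G \<epsilon>) > 0
          \<and> enn2real (vmeas_max G) > 0
        then 2 * enn2real (frac_degree G \<epsilon>)
          * (enn2real (vmeas_max G) / enn2real (weight_min G \<epsilon>))\<^sup>2 else 1)
      * max (sqrt K * h) (h\<^sup>2)"
    using \<open>d > 0\<close> \<open>\<omega> > 0\<close> \<open>m > 0\<close>
    unfolding Let_def d_def \<omega>_def m_def h_def K_def by simp
qed

end
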